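(* Let $\Phi(z)=1+B_1z+B_2z^2+B_3z^3+\cdots$ be analytic and univalent in $\mathbb{D}=\{z\in\mathbb{C}:|z|<1\}$, such that $\Phi(\mathbb{D})$ is symmetric with respect to the real axis and starlike with respect to $\Phi(0)=1$, and $\Phi'(0)=B_1>0$. Let $f(z)=z+\sum_{n=2}^{\infty}a_nz^n$ belong to the Ma--Minda convex class $\mathcal{C}(\Phi)$. Then $$|a_3|-|a_2|\le \begin{cases}\dfrac{|B_1^2+B_2|-3B_1}{6}, & \text{if } |B_1^2+B_2|\ge 4B_1,\\[6pt] \dfrac{B_1}{6}, & \text{if } |B_1^2+B_2|<4B_1,\end{cases}$$ and $$|a_3|-|a_2|\ge \begin{cases}\dfrac{|B_1^2+B_2|-3B_1}{6}, & \text{if } B_1\ge 2|B_1^2+B_2|,\\[6pt] -\dfrac{B_1}{2}\sqrt{\dfrac{B_1}{B_1+|B_1^2+B_2|}}, & \text{if } 5B_1\le 4|B_1^2+B_2|,\\[6pt] -\dfrac{B_1}{6}-\dfrac{3B_1^2}{8|B_1^2+B_2|+8B_1}, & \text{otherwise.}\end{cases}$$ These inequalities are sharp: for every such $\Phi$, each of the two applicable bounds is attained with equality by some $f\in\mathcal{C}(\Phi)$.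
   Context: $\mathcal{A}$ denotes the class of functions $f$ analytic in $\mathbb{D}$ with $f(0)=0$, $f'(0)=1$, i.e. $f(z)=z+\sum_{n\ge2}a_nz^n$. For analytic $g,h$ on $\mathbb{D}$, $g$ is subordinate to $h$, written $g\prec h$, if there is an analytic $\omega:\mathbb{D}\to\mathbb{D}$ with $\omega(0)=0$ such that $g(z)=h(\omega(z))$ for all $z\in\mathbb{D}$. For $\Phi$ as in the statement, the Ma--Minda convex class $\mathcal{C}(\Phi)$ is the set of all $f\in\mathcal{A}$ such that $1+\dfrac{zf''(z)}{f'(z)}\prec\Phi(z)$ in $\mathbb{D}$. *)

theory Defs
  imports "HOL-Complex_Analysis.Complex_Analysis"
begin

text \<open>Functions on the unit disc are total functions on the complex numbers; only their values on
  \<open>unit_disc\<close> matter below.\<close>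

abbreviation unit_disc :: "complex set" where
  "unit_disc \<equiv> ball 0 1"

abbreviation taylor_coeff :: "(complex \<Rightarrow> complex) \<Rightarrow> nat \<Rightarrow> complex" where
  "taylor_coeff f n \<equiv> fps_nth (fps_expansion f 0) n"

definition class_A :: "(complex \<Rightarrow> complex) set" where
  "class_A = {f. f holomorphic_on unit_disc \<and> f 0 = 0 \<and> deriv f 0 = 1}"

definition subordinate :: "(complex \<Rightarrow> complex) \<Rightarrow> (complex \<Rightarrow> complex) \<Rightarrow> bool" where
  "subordinate g h \<longleftrightarrow>
     g holomorphic_on unit_disc \<and> h holomorphic_on unit_disc \<and>
     (\<exists>\<omega>. \<omega> holomorphic_on unit_disc \<and> \<omega> ` unit_disc \<subseteq> unit_disc \<and> \<omega> 0 = 0 \<and>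
          (\<forall>z\<in>unit_disc. g z = h (\<omega> z)))"

text \<open>The library predicate \<open>starlike\<close> does not name the centre, so the centre is made explicit
  here.\<close>

definition starlike_wrt :: "complex \<Rightarrow> complex set \<Rightarrow> bool" where
  "starlike_wrt a S \<longleftrightarrow> a \<in> S \<and> (\<forall>w\<in>S. closed_segment a w \<subseteq> S)"

text \<open>Division by zero does not enlarge this class: at a zero of \<open>deriv f\<close> the quotient is unbounded
  nearby, contradicting the holomorphy of the left-hand side required by \<open>subordinate\<close>.\<close>

definition Ma_Minda_convex :: "(complex \<Rightarrow> complex) \<Rightarrow> (complex \<Rightarrow> complex) set" where
  "Ma_Minda_convex \<Phi> =
     {f \<in> class_A. subordinate (\<lambda>z. 1 + z * deriv (deriv f) z / deriv f z) \<Phi>}"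

end

theory Submission
  imports Defs
begin

text \<open>
Membership in the class means \<open>1 + z f'' / f' = \<Phi> \<circ> \<omega>\<close> for a Schwarz function
\<open>\<omega>(z) = c1 z + c2 z\<^sup>2 + \<dots>\<close>, that is, a holomorphic self-map of the disc fixing the origin.
Comparing coefficients in \<open>z f'' = f' (\<Phi> \<circ> \<omega> - 1)\<close> gives, with \<open>D = B1\<^sup>2 + B2\<close>,
\<open>a2 = B1 c1 / 2\<close> and \<open>6 a3 = B1 c2 + D c1\<^sup>2\<close>
(\<open>Ma_Minda_convex_coeffs\<close>). The Schwarz-Pick lemma applied to \<open>\<omega>(z) / z\<close> restricts the pair
to \<open>|c1| \<le> 1\<close>, \<open>|c2| \<le> 1 - |c1|\<^sup>2\<close> (\<open>schwarz_coeff_bounds\<close>).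

Put \<open>x = |c1|\<close> and \<open>M = |D|\<close>. For fixed \<open>x\<close>, the triangle inequality confines \<open>6 |a3|\<close> to the
interval from \<open>max 0 (M x\<^sup>2 - B1 (1 - x\<^sup>2))\<close> to \<open>M x\<^sup>2 + B1 (1 - x\<^sup>2)\<close>, while
\<open>|a2| = B1 x / 2\<close>. So both bounds are extrema of piecewise quadratic functions of
\<open>x \<in> [0, 1]\<close>. The upper function is convex or decreasing, so its maximum is at
\<open>x = 0\<close> or \<open>x = 1\<close>. The lower function decreases linearly until \<open>a3\<close> may no longer vanish, at
\<open>x0 = sqrt (B1 / (B1 + M))\<close>, and is then a parabola with vertex \<open>3 B1 / (2 (B1 + M))\<close>; the three
cases of the lower bound say whether this vertex lies beyond \<open>1\<close>, before \<open>x0\<close>, or in between.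

Sharpness holds because every extremal pair is realised. The Blaschke products
\<open>z (x + \<zeta> z) / (1 + x \<zeta> z)\<close> with \<open>|\<zeta>| = 1\<close> have \<open>c1 = x\<close> and \<open>c2 = \<zeta> (1 - x\<^sup>2)\<close>, and the
differential equation for \<open>f\<close> can be solved by two integrations for any right-hand side taking the
value \<open>1\<close> at the origin (\<open>class_A_with_convexity_quotient\<close>). Choosing \<open>\<zeta>\<close> opposite to the
argument of \<open>D\<close> gives equality in the lower triangle inequality.
\<close>

section \<open>The first two coefficients of a Schwarz function\<close>

lemma taylor_coeff_0_1 [simp]:
  "taylor_coeff f 0 = f 0" "taylor_coeff f (Suc 0) = deriv f 0"
  by (simp_all add: fps_expansion_def)

lemma has_fps_expansion_unit_disc:
  assumes "f holomorphic_on unit_disc"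
  shows "f has_fps_expansion fps_expansion f 0"
  by (rule has_fps_expansion_fps_expansion[OF _ _ assms]) auto

lemma taylor_coeff_eqI:
  assumes "f has_fps_expansion F"
  shows "taylor_coeff f n = fps_nth F n"
  using fps_nth_fps_expansion[OF assms] by (simp add: fps_expansion_def)

text \<open>Composing with the disc automorphism that sends \<open>h 0\<close> to the origin reduces this to the Schwarz
  lemma. That automorphism needs \<open>|h 0| < 1\<close>; a function that reaches modulus \<open>1\<close> inside the disc
  is constant by the maximum principle and satisfies the bound trivially.\<close>
lemma schwarz_pick_at_0:
  assumes h: "h holomorphic_on unit_disc" and le: "\<And>z. z \<in> unit_disc \<Longrightarrow> cmod (h z) \<le> 1"
  shows "cmod (deriv h 0) \<le> 1 - (cmod (h 0))\<^sup>2"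
proof (cases "\<exists>z\<in>unit_disc. cmod (h z) = 1")
  case True
  then obtain w where w: "w \<in> unit_disc" "cmod (h w) = 1" by blast
  have "h constant_on unit_disc"
    by (rule maximum_modulus_principle[OF h, of unit_disc w]) (use w le in auto)
  then obtain c where c: "\<And>z. z \<in> unit_disc \<Longrightarrow> h z = c"
    by (auto simp: constant_on_def)
  have "eventually (\<lambda>z. h z = c) (nhds 0)"
    using c by (auto simp: eventually_nhds intro!: exI[of _ unit_disc])
  then have "deriv h 0 = deriv (\<lambda>_. c) 0"
    by (rule deriv_cong_ev) simp
  then show ?thesis using le[of 0] by (simp add: power_le_one)
next
  case False
  then have less: "cmod (h z) < 1" if "z \<in> unit_disc" for z
    using le[OF that] that by force
  define a where "a = h 0"
  have a: "cmod a < 1" using less[of 0] by (simp add: a_def)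
  have na: "1 - cnj a * a = of_real (1 - (cmod a)\<^sup>2)"
    using complex_norm_square[of a] by (simp add: mult.commute)
  have pos: "0 < 1 - (cmod a)\<^sup>2" using a by (simp add: power_less_one_iff abs_square_less_1)
  define m where "m = (\<lambda>z. Moebius_function 0 a (h z))"
  have m_hol: "m holomorphic_on unit_disc"
    using holomorphic_on_compose_gen[OF h Moebius_function_holomorphic[OF a, of 0]] less
    by (simp add: m_def o_def image_subset_iff)
  have "cmod (deriv m 0) \<le> 1"
    by (rule Schwarz_Lemma(2)[OF m_hol, of 0])
       (use less a in \<open>auto simp: m_def a_def[symmetric] Moebius_function_eq_zero intro!: Moebius_function_norm_lt_1\<close>)
  moreover have "deriv m 0 = deriv h 0 / of_real (1 - (cmod a)\<^sup>2)"
  proof (rule DERIV_imp_deriv)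
    have "(h has_field_derivative deriv h 0) (at 0)"
      by (rule holomorphic_derivI[OF h]) auto
    then show "(m has_field_derivative deriv h 0 / of_real (1 - (cmod a)\<^sup>2)) (at 0)"
      unfolding m_def Moebius_function_simple na[symmetric]
      using pos na by (auto intro!: derivative_eq_intros simp: a_def[symmetric] simp del: of_real_diff)
  qed
  ultimately show ?thesis using pos
    by (simp add: norm_divide a_def divide_le_eq del: of_real_diff)
qed

text \<open>By the Schwarz lemma \<open>\<omega>(z) = z h(z)\<close> with \<open>|h| \<le> 1\<close>, and the two coefficients are the value and
  the derivative of \<open>h\<close> at the origin.\<close>
lemma schwarz_coeff_bounds:
  assumes \<omega>: "\<omega> holomorphic_on unit_disc" "\<omega> ` unit_disc \<subseteq> unit_disc" "\<omega> 0 = 0"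
  shows "cmod (taylor_coeff \<omega> 1) \<le> 1"
    and "cmod (taylor_coeff \<omega> 2) \<le> 1 - (cmod (taylor_coeff \<omega> 1))\<^sup>2"
proof -
  obtain h where h: "h holomorphic_on unit_disc" "\<And>z. cmod z < 1 \<Longrightarrow> \<omega> z = z * h z"
      "deriv \<omega> 0 = h 0"
    using Schwarz3[OF \<omega>(1,3)] by blast
  have lt: "cmod (\<omega> z) < 1" if "cmod z < 1" for z
    using \<omega>(2) that by force
  note schwarz = Schwarz_Lemma(1,2)[OF \<omega>(1,3) lt]
  have h_le: "cmod (h z) \<le> 1" if "z \<in> unit_disc" for z
  proof (cases "z = 0")
    case True
    then show ?thesis using schwarz(2)[of 0] h(3) by simp
  next
    case False
    then show ?thesis using schwarz(1)[of z] h(2)[of z] that by (simp add: norm_mult)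
  qed
  have "(\<lambda>z. z * h z) has_fps_expansion fps_X * fps_expansion h 0"
    by (intro fps_expansion_intros has_fps_expansion_unit_disc h)
  moreover have "eventually (\<lambda>z. z * h z = \<omega> z) (nhds 0)"
    using h(2) by (auto simp: eventually_nhds intro!: exI[of _ unit_disc])
  ultimately have \<omega>_exp: "\<omega> has_fps_expansion fps_X * fps_expansion h 0"
    using has_fps_expansion_cong[of "\<lambda>z. z * h z" \<omega>] by blast
  have c: "taylor_coeff \<omega> 1 = h 0" "taylor_coeff \<omega> 2 = deriv h 0"
    unfolding taylor_coeff_eqI[OF \<omega>_exp] by (simp_all add: numeral_2_eq_2)
  show "cmod (taylor_coeff \<omega> 1) \<le> 1"
    using h_le[of 0] c by simp
  show "cmod (taylor_coeff \<omega> 2) \<le> 1 - (cmod (taylor_coeff \<omega> 1))\<^sup>2"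
    unfolding c by (rule schwarz_pick_at_0[OF h(1) h_le])
qed

text \<open>Equality in the second bound of \<open>schwarz_coeff_bounds\<close>, with prescribed \<open>c1 = x \<ge> 0\<close> and
  argument of \<open>c2\<close>, is attained by \<open>z \<psi>(z)\<close>, where \<open>\<psi>\<close> maps the origin to \<open>x\<close> and is a disc automorphism for \<open>x < 1\<close>. The formula for
  \<open>\<psi>\<close> stays valid at \<open>x = 1\<close>, where it degenerates to the constant \<open>1\<close>; for this reason only
  \<open>|\<psi>| \<le> 1\<close> is shown, and the factor \<open>z\<close> supplies the strict inequality.\<close>
lemma schwarz_function_with_coeffs:
  fixes x :: real and \<zeta> :: complex
  assumes x: "0 \<le> x" "x \<le> 1" and \<zeta>: "cmod \<zeta> = 1"
  obtains \<omega> where "\<omega> holomorphic_on unit_disc" "\<omega> ` unit_disc \<subseteq> unit_disc" "\<omega> 0 = 0"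
    "taylor_coeff \<omega> 1 = of_real x" "taylor_coeff \<omega> 2 = \<zeta> * of_real (1 - x\<^sup>2)"
proof -
  define \<psi> where "\<psi> = (\<lambda>z. (of_real x + \<zeta> * z) / (1 + of_real x * \<zeta> * z))"
  have nz: "1 + of_real x * \<zeta> * z \<noteq> 0" if "cmod z < 1" for z
  proof
    assume "1 + of_real x * \<zeta> * z = 0"
    then have "of_real x * \<zeta> * z = -1"
      by (metis add.commute eq_neg_iff_add_eq_0)
    then have "cmod (of_real x * \<zeta> * z) = 1" by simp
    then have "x * cmod z = 1" using x \<zeta> by (simp add: norm_mult)
    moreover have "x * cmod z \<le> cmod z" using x by (simp add: mult_left_le_one_le)
    ultimately show False using that by simp
  qed
  have le: "cmod (\<psi> z) \<le> 1" if z: "cmod z < 1" for z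
  proof -
    define u where "u = \<zeta> * z"
    have u: "cmod u < 1" using z \<zeta> by (simp add: u_def norm_mult)
    have "(cmod (1 + of_real x * u))\<^sup>2 - (cmod (of_real x + u))\<^sup>2
        = (1 - x\<^sup>2) * (1 - (cmod u)\<^sup>2)"
      unfolding cmod_power2 by (simp add: power2_eq_square algebra_simps)
    also have "\<dots> \<ge> 0"
      using x u by (intro mult_nonneg_nonneg) (auto simp: power_le_one)
    finally have "cmod (of_real x + u) \<le> cmod (1 + of_real x * u)"
      by (simp add: power_mono_iff)
    then show ?thesis using nz[OF z]
      by (simp add: \<psi>_def u_def norm_divide mult.assoc divide_le_eq)
  qed
  have \<psi>_hol: "\<psi> holomorphic_on unit_disc"
    unfolding \<psi>_def by (intro holomorphic_intros) (use nz in auto)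
  have \<psi>_deriv: "deriv \<psi> 0 = \<zeta> * of_real (1 - x\<^sup>2)"
    unfolding \<psi>_def
    by (rule DERIV_imp_deriv)
       (auto intro!: derivative_eq_intros simp: algebra_simps power2_eq_square)
  define \<omega> where "\<omega> = (\<lambda>z. z * \<psi> z)"
  have \<omega>_exp: "\<omega> has_fps_expansion fps_X * fps_expansion \<psi> 0"
    unfolding \<omega>_def by (intro fps_expansion_intros has_fps_expansion_unit_disc \<psi>_hol)
  show ?thesis
  proof
    show "\<omega> holomorphic_on unit_disc"
      unfolding \<omega>_def by (intro holomorphic_intros \<psi>_hol)
    show "\<omega> ` unit_disc \<subseteq> unit_disc"
    proof
      fix w assume "w \<in> \<omega> ` unit_disc"
      then obtain z where z: "cmod z < 1" "w = z * \<psi> z" by (auto simp: \<omega>_def)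
      then have "cmod w \<le> cmod z"
        using le[OF z(1)] by (simp add: norm_mult mult_left_le)
      then show "w \<in> unit_disc" using z by simp
    qed
    show "\<omega> 0 = 0" by (simp add: \<omega>_def)
    show "taylor_coeff \<omega> 1 = of_real x" "taylor_coeff \<omega> 2 = \<zeta> * of_real (1 - x\<^sup>2)"
      unfolding taylor_coeff_eqI[OF \<omega>_exp] using \<psi>_deriv
      by (simp_all add: numeral_2_eq_2 \<psi>_def)
  qed
qed

section \<open>The differential equation defining the class\<close>

text \<open>Since \<open>f' \<noteq> 0\<close> near the origin, the equation can be cleared of its denominator there, and
  \<open>z f'' = f' (P - 1)\<close> becomes an identity of formal power series; its coefficients of \<open>z\<close> and
  \<open>z\<^sup>2\<close> are \<open>2 a2 = p1\<close> and \<open>6 a3 = p2 + 2 a2 p1\<close>.\<close>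
lemma taylor_coeffs_of_convexity_quotient:
  assumes f: "f holomorphic_on unit_disc" "deriv f 0 = 1" and P: "P holomorphic_on unit_disc"
    and eq: "\<And>z. z \<in> unit_disc \<Longrightarrow> 1 + z * deriv (deriv f) z / deriv f z = P z"
  shows "taylor_coeff f 2 = taylor_coeff P 1 / 2"
    and "taylor_coeff f 3 = (taylor_coeff P 2 + (taylor_coeff P 1)\<^sup>2) / 6"
proof -
  define F where "F = fps_expansion f 0"
  define Q where "Q = fps_expansion P 0"
  have F: "f has_fps_expansion F" and Q: "P has_fps_expansion Q"
    unfolding F_def Q_def using f(1) P by (auto intro: has_fps_expansion_unit_disc)
  have F': "deriv f has_fps_expansion fps_deriv F"
    and F'': "deriv (deriv f) has_fps_expansion fps_deriv (fps_deriv F)"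
    by (intro has_fps_expansion_deriv F)+
  have F1: "fps_nth F (Suc 0) = 1" using f(2) by (simp add: F_def)
  have P0: "P 0 = 1" using eq[of 0] by simp
  have Q0: "fps_nth Q 0 = 1" using P0 by (simp add: Q_def)
  have "deriv f holomorphic_on unit_disc"
    by (intro holomorphic_deriv f) auto
  then have "isCont (deriv f) 0"
    using continuous_on_eq_continuous_at[OF open_ball] holomorphic_on_imp_continuous_on by force
  then have ev_nz: "eventually (\<lambda>z. deriv f z \<noteq> 0) (nhds 0)"
    using f(2) by (intro tendsto_imp_eventually_ne[of "deriv f" 1])
      (auto simp: isCont_def tendsto_nhds_iff)
  have ev_disc: "eventually (\<lambda>z. z \<in> unit_disc) (nhds (0::complex))"
    by (intro eventually_nhds_in_open) auto
  have ode: "eventually (\<lambda>z. z * deriv (deriv f) z = deriv f z * (P z - 1)) (nhds 0)"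
    using ev_nz ev_disc
    by eventually_elim (simp flip: eq)
  have lhs: "(\<lambda>z. z * deriv (deriv f) z) has_fps_expansion fps_X * fps_deriv (fps_deriv F)"
    and rhs: "(\<lambda>z. deriv f z * (P z - 1)) has_fps_expansion fps_deriv F * (Q - 1)"
    by (intro fps_expansion_intros F' F'' Q)+
  have fps_eq: "fps_X * fps_deriv (fps_deriv F) = fps_deriv F * (Q - 1)"
    using has_fps_expansion_cong[OF ode refl, THEN iffD1, OF lhs] rhs
    by (rule fps_expansion_unique_complex)
  have "fps_nth (fps_X * fps_deriv (fps_deriv F)) 1 = fps_nth (fps_deriv F * (Q - 1)) 1"
    using fps_eq by simp
  then have c2: "2 * fps_nth F 2 = fps_nth Q 1"
    using F1 Q0 by (simp add: fps_mult_nth numeral_2_eq_2)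
  have "fps_nth (fps_X * fps_deriv (fps_deriv F)) 2 = fps_nth (fps_deriv F * (Q - 1)) 2"
    using fps_eq by simp
  then have c3: "6 * fps_nth F 3 = fps_nth Q 2 + 2 * fps_nth F 2 * fps_nth Q 1"
    using F1 Q0 by (simp add: fps_mult_nth numeral_2_eq_2 numeral_3_eq_3 algebra_simps)
  show "taylor_coeff f 2 = taylor_coeff P 1 / 2"
    using c2 by (simp add: F_def Q_def field_simps)
  show "taylor_coeff f 3 = (taylor_coeff P 2 + (taylor_coeff P 1)\<^sup>2) / 6"
    using c3 unfolding c2 by (simp add: F_def Q_def field_simps power2_eq_square)
qed

lemma taylor_coeffs_compose:
  assumes \<Phi>: "\<Phi> holomorphic_on unit_disc" and \<omega>: "\<omega> holomorphic_on unit_disc" "\<omega> 0 = 0"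
  shows "taylor_coeff (\<lambda>z. \<Phi> (\<omega> z)) 1 = deriv \<Phi> 0 * taylor_coeff \<omega> 1"
    and "taylor_coeff (\<lambda>z. \<Phi> (\<omega> z)) 2
           = deriv \<Phi> 0 * taylor_coeff \<omega> 2 + taylor_coeff \<Phi> 2 * (taylor_coeff \<omega> 1)\<^sup>2"
proof -
  define W where "W = fps_expansion \<omega> 0"
  have W0: "fps_nth W 0 = 0" using \<omega>(2) by (simp add: W_def)
  have "(\<Phi> \<circ> \<omega>) has_fps_expansion (fps_expansion \<Phi> 0 oo W)"
    by (intro has_fps_expansion_compose has_fps_expansion_unit_disc \<Phi> W0)
       (auto simp: W_def intro!: has_fps_expansion_unit_disc \<omega>)
  then have exp: "(\<lambda>z. \<Phi> (\<omega> z)) has_fps_expansion (fps_expansion \<Phi> 0 oo W)"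
    by (simp add: o_def)
  show "taylor_coeff (\<lambda>z. \<Phi> (\<omega> z)) 1 = deriv \<Phi> 0 * taylor_coeff \<omega> 1"
    unfolding taylor_coeff_eqI[OF exp] by (simp add: fps_compose_nth W_def)
  have "{0..2::nat} = {0, 1, 2}" by auto
  then show "taylor_coeff (\<lambda>z. \<Phi> (\<omega> z)) 2
      = deriv \<Phi> 0 * taylor_coeff \<omega> 2 + taylor_coeff \<Phi> 2 * (taylor_coeff \<omega> 1)\<^sup>2"
    unfolding taylor_coeff_eqI[OF exp] using W0
    by (simp add: fps_compose_nth power2_eq_square fps_mult_nth W_def flip: numeral_2_eq_2)
qed

text \<open>The equation says \<open>(log f')' = q\<close> with \<open>q = (P - 1) / z\<close>, which is holomorphic because
  \<open>P 0 = 1\<close>. So \<open>f'\<close> is the exponential of the primitive of \<open>q\<close> that vanishes at the origin, and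
  \<open>f\<close> is a primitive of that.\<close>
lemma class_A_with_convexity_quotient:
  assumes P: "P holomorphic_on unit_disc" "P 0 = 1"
  obtains f where "f \<in> class_A"
    and "\<And>z. z \<in> unit_disc \<Longrightarrow> 1 + z * deriv (deriv f) z / deriv f z = P z"
proof -
  have "(\<lambda>z. P z - 1) holomorphic_on unit_disc"
    by (intro holomorphic_intros P)
  then obtain q where q: "q holomorphic_on unit_disc" "\<And>z. cmod z < 1 \<Longrightarrow> P z - 1 = z * q z"
    using Schwarz3[of "\<lambda>z. P z - 1" 1] P(2) by auto
  have primitive: "\<exists>F. \<forall>z\<in>unit_disc. (F has_field_derivative g z) (at z)"
    if g: "g holomorphic_on unit_disc" for g
  proof -
    obtain F where "\<And>z. z \<in> unit_disc \<Longrightarrow> (F has_field_derivative g z) (at z within unit_disc)"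
      using holomorphic_convex_primitive'[OF _ _ g] by auto
    then show ?thesis
      by (metis at_within_open open_ball)
  qed
  obtain p where p: "\<And>z. z \<in> unit_disc \<Longrightarrow> (p has_field_derivative q z) (at z)"
    using primitive[OF q(1)] by blast
  define e where "e = (\<lambda>z. exp (p z - p 0))"
  have e_deriv: "(e has_field_derivative q z * e z) (at z)" if "z \<in> unit_disc" for z
    unfolding e_def using p[OF that] by (auto intro!: derivative_eq_intros)
  have "e holomorphic_on unit_disc"
    using e_deriv by (meson holomorphic_on_open open_ball)
  then obtain E where E: "\<And>z. z \<in> unit_disc \<Longrightarrow> (E has_field_derivative e z) (at z)"
    using primitive by blast
  define f where "f = (\<lambda>z. E z - E 0)"
  have f_deriv: "(f has_field_derivative e z) (at z)" if "z \<in> unit_disc" for z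
    unfolding f_def using E[OF that] by (auto intro!: derivative_eq_intros)
  have f': "deriv f z = e z" if "z \<in> unit_disc" for z
    using f_deriv[OF that] by (rule DERIV_imp_deriv)
  have f'': "deriv (deriv f) z = q z * e z" if z: "z \<in> unit_disc" for z
  proof -
    have "eventually (\<lambda>w. deriv f w = e w) (nhds z)"
      using eventually_nhds_in_open[OF open_ball z] by eventually_elim (rule f')
    then have "deriv (deriv f) z = deriv e z"
      by (rule deriv_cong_ev) simp
    then show ?thesis using DERIV_imp_deriv[OF e_deriv[OF z]] by simp
  qed
  have f_hol: "f holomorphic_on unit_disc"
    using f_deriv by (meson holomorphic_on_open open_ball)
  show ?thesis
  proof
    show "f \<in> class_A"
      using f_hol f'[of 0] by (simp add: class_A_def e_def) (simp add: f_def)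
    fix z assume z: "z \<in> unit_disc"
    have "e z \<noteq> 0" by (simp add: e_def)
    then show "1 + z * deriv (deriv f) z / deriv f z = P z"
      using f'[OF z] f''[OF z] q(2)[of z] z by (simp add: algebra_simps)
  qed
qed

lemma Ma_Minda_convex_coeffs:
  assumes \<Phi>: "\<Phi> holomorphic_on unit_disc" and f: "f \<in> Ma_Minda_convex \<Phi>"
  obtains c1 c2 where "cmod c1 \<le> 1" "cmod c2 \<le> 1 - (cmod c1)\<^sup>2"
    "taylor_coeff f 2 = deriv \<Phi> 0 * c1 / 2"
    "taylor_coeff f 3 = (deriv \<Phi> 0 * c2 + ((deriv \<Phi> 0)\<^sup>2 + taylor_coeff \<Phi> 2) * c1\<^sup>2) / 6"
proof -
  obtain \<omega> where \<omega>: "\<omega> holomorphic_on unit_disc" "\<omega> ` unit_disc \<subseteq> unit_disc" "\<omega> 0 = 0"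
    and eq: "\<And>z. z \<in> unit_disc \<Longrightarrow> 1 + z * deriv (deriv f) z / deriv f z = \<Phi> (\<omega> z)"
    using f by (auto simp: Ma_Minda_convex_def subordinate_def)
  have f_hol: "f holomorphic_on unit_disc" "deriv f 0 = 1"
    using f by (auto simp: Ma_Minda_convex_def class_A_def)
  have comp: "(\<lambda>z. \<Phi> (\<omega> z)) holomorphic_on unit_disc"
    using holomorphic_on_compose_gen[OF \<omega>(1) \<Phi> \<omega>(2)] by (simp add: o_def)
  note coeffs = taylor_coeffs_of_convexity_quotient[OF f_hol comp eq]
    taylor_coeffs_compose[OF \<Phi> \<omega>(1,3)]
  show ?thesis
  proof (rule that[OF schwarz_coeff_bounds[OF \<omega>]])
    show "taylor_coeff f 2 = deriv \<Phi> 0 * taylor_coeff \<omega> 1 / 2"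
      by (simp only: coeffs)
    show "taylor_coeff f 3 = (deriv \<Phi> 0 * taylor_coeff \<omega> 2
        + ((deriv \<Phi> 0)\<^sup>2 + taylor_coeff \<Phi> 2) * (taylor_coeff \<omega> 1)\<^sup>2) / 6"
      by (simp only: coeffs power_mult_distrib distrib_right add_ac)
  qed
qed

lemma Ma_Minda_convex_with_coeffs:
  fixes x :: real and \<zeta> :: complex
  assumes \<Phi>: "\<Phi> holomorphic_on unit_disc" "\<Phi> 0 = 1"
    and x: "0 \<le> x" "x \<le> 1" and \<zeta>: "cmod \<zeta> = 1"
  obtains f where "f \<in> Ma_Minda_convex \<Phi>"
    "taylor_coeff f 2 = deriv \<Phi> 0 * of_real x / 2"
    "taylor_coeff f 3 = (deriv \<Phi> 0 * \<zeta> * of_real (1 - x\<^sup>2)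
        + ((deriv \<Phi> 0)\<^sup>2 + taylor_coeff \<Phi> 2) * of_real (x\<^sup>2)) / 6"
proof -
  obtain \<omega> where \<omega>: "\<omega> holomorphic_on unit_disc" "\<omega> ` unit_disc \<subseteq> unit_disc" "\<omega> 0 = 0"
    and c: "taylor_coeff \<omega> 1 = of_real x" "taylor_coeff \<omega> 2 = \<zeta> * of_real (1 - x\<^sup>2)"
    by (rule schwarz_function_with_coeffs[OF x \<zeta>])
  have comp: "(\<lambda>z. \<Phi> (\<omega> z)) holomorphic_on unit_disc"
    using holomorphic_on_compose_gen[OF \<omega>(1) \<Phi>(1) \<omega>(2)] by (simp add: o_def)
  have "\<Phi> (\<omega> 0) = 1" using \<Phi>(2) \<omega>(3) by simp
  then obtain f where f: "f \<in> class_A"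
    and eq: "\<And>z. z \<in> unit_disc \<Longrightarrow> 1 + z * deriv (deriv f) z / deriv f z = \<Phi> (\<omega> z)"
    by (rule class_A_with_convexity_quotient[OF comp]) blast
  have f_hol: "f holomorphic_on unit_disc" "deriv f 0 = 1"
    using f by (auto simp: class_A_def)
  have "(\<lambda>z. 1 + z * deriv (deriv f) z / deriv f z) holomorphic_on unit_disc"
    by (rule holomorphic_transform[OF comp]) (simp add: eq)
  then have "f \<in> Ma_Minda_convex \<Phi>"
    unfolding Ma_Minda_convex_def subordinate_def
    using f \<Phi>(1) \<omega> eq by (intro CollectI conjI exI[of _ \<omega>]) auto
  note coeffs = taylor_coeffs_of_convexity_quotient[OF f_hol comp eq]
    taylor_coeffs_compose[OF \<Phi>(1) \<omega>(1,3)]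
  show ?thesis
  proof (rule that[OF \<open>f \<in> Ma_Minda_convex \<Phi>\<close>])
    show "taylor_coeff f 2 = deriv \<Phi> 0 * of_real x / 2"
      by (simp only: coeffs c)
    show "taylor_coeff f 3 = (deriv \<Phi> 0 * \<zeta> * of_real (1 - x\<^sup>2)
        + ((deriv \<Phi> 0)\<^sup>2 + taylor_coeff \<Phi> 2) * of_real (x\<^sup>2)) / 6"
      by (simp only: coeffs c power_mult_distrib distrib_right of_real_power mult.assoc add_ac)
  qed
qed

section \<open>The extremal problem in one real variable\<close>

text \<open>On \<open>[0, 1]\<close> one has \<open>x\<^sup>2 \<le> x\<close>, so the quadratic term lies below its chord when \<open>M \<ge> B\<close> and is
  nonpositive otherwise. What remains is linear in \<open>x\<close> and maximal at an endpoint.\<close>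
lemma upper_bound_real:
  fixes B M x :: real
  assumes "B > 0" "0 \<le> x" "x \<le> 1"
  shows "(B * (1 - x\<^sup>2) + M * x\<^sup>2) / 6 - B * x / 2
    \<le> (if M \<ge> 4 * B then (M - 3 * B) / 6 else B / 6)"
proof -
  have x2: "x\<^sup>2 \<le> x" "0 \<le> x\<^sup>2" 
    using mult_left_le[of x x] assms by (simp_all add: power2_eq_square)
  have "(M - B) * x\<^sup>2 \<le> max 0 (M - B) * x\<^sup>2"
    using x2(2) by (intro mult_right_mono) auto
  also have "\<dots> \<le> max 0 (M - B) * x"
    using x2(1) by (intro mult_left_mono) auto
  finally have chord: "(M - B) * x\<^sup>2 \<le> max 0 (M - B) * x" .
  show ?thesis
  proof (cases "M \<ge> 4 * B")
    case True
    have "(M - 4 * B) * x \<le> M - 4 * B" using True assms by (simp add: mult_left_le)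
    with chord True assms(1) have "B * (1 - x\<^sup>2) + M * x\<^sup>2 - 3 * B * x \<le> M - 3 * B"
      by (simp add: algebra_simps max_def)
    then show ?thesis using True by (simp add: field_simps)
  next
    case False
    have "max 0 (M - B) * x \<le> 3 * B * x"
      using False assms by (intro mult_right_mono) auto
    with chord have "B * (1 - x\<^sup>2) + M * x\<^sup>2 - 3 * B * x \<le> B"
      by (simp add: algebra_simps)
    then show ?thesis using False by (simp add: field_simps)
  qed
qed

text \<open>Here \<open>t\<close> stands for \<open>|a3|\<close>. In each case the parabola \<open>S x\<^sup>2 - 3 B x - B\<close>, with
  \<open>S = M + B\<close>, is compared with its value at the minimiser by factoring the difference: at \<open>1\<close>, at
  \<open>sqrt (B / S)\<close>, or at the vertex, where the difference is a multiple of a square. To the left of \<open>sqrt (B / S)\<close> the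
  parabola says nothing useful and \<open>t \<ge> 0\<close> is the effective bound.\<close>
lemma lower_bound_real:
  fixes B M x t :: real
  assumes B: "B > 0" and M: "M \<ge> 0" and x: "0 \<le> x" "x \<le> 1"
    and t: "t \<ge> 0" "6 * t \<ge> (M + B) * x\<^sup>2 - B"
  shows "t - B * x / 2 \<ge>
    (if B \<ge> 2 * M then (M - 3 * B) / 6
     else if 5 * B \<le> 4 * M then - (B / 2) * sqrt (B / (B + M))
     else - B / 6 - 3 * B\<^sup>2 / (8 * M + 8 * B))"
proof -
  define S where "S = M + B"
  have S: "S > 0" using B M by (simp add: S_def)
  consider "B \<ge> 2 * M" | "B < 2 * M" "5 * B \<le> 4 * M" | "B < 2 * M" "4 * M < 5 * B"
    by linarith
  then show ?thesis
  proof cases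
    case 1
    have "(1 - x) * (3 * B - S * (1 + x)) \<ge> 0"
    proof (intro mult_nonneg_nonneg)
      have "S * (1 + x) \<le> S * 2" using S x by (intro mult_left_mono) auto
      then show "0 \<le> 3 * B - S * (1 + x)" using 1 by (simp add: S_def)
    qed (use x in auto)
    then have "S * x\<^sup>2 - B - 3 * B * x \<ge> M - 3 * B"
      by (simp add: S_def power2_eq_square algebra_simps)
    with t(2) 1 show ?thesis by (simp add: S_def)
  next
    case 2
    define y where "y = sqrt (B / (B + M))"
    have y: "y \<ge> 0" "S * y\<^sup>2 = B" using B M by (auto simp: y_def S_def add.commute)
    have "(S * y)\<^sup>2 = S * B" using y(2) by (simp add: power2_eq_square algebra_simps)
    moreover have "(3 * B / 2)\<^sup>2 \<le> S * B"
      using 2 B by (simp add: power2_eq_square S_def field_simps)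
    \<comment> \<open>The vertex of the parabola lies to the left of \<open>y\<close>.\<close>
    ultimately have Sy: "3 * B / 2 \<le> S * y"
      using y(1) S by (metis mult_nonneg_nonneg less_imp_le power2_le_imp_le)
    have "t - B * x / 2 \<ge> - (B / 2) * y"
    proof (cases "x \<le> y")
      case True
      then have "B * x \<le> B * y" using B by simp
      then show ?thesis using t(1) by simp
    next
      case False
      have "(x - y) * (S * (x + y) - 3 * B) \<ge> 0"
      proof (intro mult_nonneg_nonneg)
        have "S * x \<ge> S * y" using False S by simp
        then show "0 \<le> S * (x + y) - 3 * B" using Sy by (simp add: algebra_simps)
      qed (use False in auto)
      then have "S * x\<^sup>2 - S * y\<^sup>2 - 3 * B * x + 3 * B * y \<ge> 0"
        by (simp add: power2_eq_square algebra_simps)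
      then show ?thesis using t(2) y(2) by (simp add: S_def)
    qed
    with 2 show ?thesis by (simp add: y_def)
  next
    case 3
    have "(2 * S * x - 3 * B)\<^sup>2 / (4 * S) \<ge> 0" using S by simp
    also have "(2 * S * x - 3 * B)\<^sup>2 / (4 * S) = S * x\<^sup>2 - 3 * B * x + 9 * B\<^sup>2 / (4 * S)"
      using S by (simp add: power2_eq_square field_simps)
    finally have square: "S * x\<^sup>2 - 3 * B * x + 9 * B\<^sup>2 / (4 * S) \<ge> 0" .
    have "9 * B\<^sup>2 / (4 * S) = 6 * (3 * B\<^sup>2 / (8 * M + 8 * B))"
      using S by (simp add: S_def field_simps)
    with square t(2) have "t - B * x / 2 \<ge> - B / 6 - 3 * B\<^sup>2 / (8 * M + 8 * B)"
      unfolding S_def[symmetric] by argo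
    then show ?thesis using 3 by simp
  qed
qed

text \<open>The minimisers are \<open>1\<close>, the zero \<open>sqrt (B / (B + M))\<close> of the term inside the modulus, and the
  vertex \<open>3 B / (2 (B + M))\<close>. In the last case the vertex has to lie beyond that zero, so that the
  modulus opens with a positive sign.\<close>
lemma lower_bound_attained_real:
  fixes B M :: real
  assumes B: "B > 0" and M: "M \<ge> 0"
  obtains x where "0 \<le> x" "x \<le> 1"
    "\<bar>M * x\<^sup>2 - B * (1 - x\<^sup>2)\<bar> / 6 - B * x / 2 =
      (if B \<ge> 2 * M then (M - 3 * B) / 6
       else if 5 * B \<le> 4 * M then - (B / 2) * sqrt (B / (B + M))
       else - B / 6 - 3 * B\<^sup>2 / (8 * M + 8 * B))"
proof -
  define S where "S = M + B"
  have S: "S > 0" using B M by (simp add: S_def)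
  consider "B \<ge> 2 * M" | "B < 2 * M" "5 * B \<le> 4 * M" | "B < 2 * M" "4 * M < 5 * B"
    by linarith
  then show ?thesis
  proof cases
    case 1
    show ?thesis by (rule that[of 1]) (use 1 M in auto)
  next
    case 2
    define y where "y = sqrt (B / (B + M))"
    have y: "y \<ge> 0" "S * y\<^sup>2 = B" using B M by (auto simp: y_def S_def add.commute)
    have zero: "M * y\<^sup>2 - B * (1 - y\<^sup>2) = 0" using y(2) by (simp add: S_def algebra_simps)
    have "y \<le> 1" using B M by (simp add: y_def)
    then show ?thesis
      by (rule that[OF y(1)]) (use 2 zero in \<open>simp add: y_def\<close>)
  next
    case 3
    define y where "y = 3 * B / (2 * S)"
    have y: "0 \<le> y" "y \<le> 1" "S * y = 3 * B / 2" 
      using B S 3 by (auto simp: y_def) (simp add: S_def)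
    have Sy2: "S * y\<^sup>2 = 9 * B\<^sup>2 / (4 * S)"
      using S by (simp add: y_def power2_eq_square field_simps)
    \<comment> \<open>The case condition \<open>4 M < 5 B\<close> places the vertex beyond the zero.\<close>
    have "B * (4 * S) \<le> 9 * B\<^sup>2"
      using 3 B by (simp add: S_def power2_eq_square)
    then have "B \<le> S * y\<^sup>2" unfolding Sy2 using S by (simp add: field_simps)
    then have "\<bar>M * y\<^sup>2 - B * (1 - y\<^sup>2)\<bar> = S * y\<^sup>2 - B"
      by (simp add: S_def algebra_simps)
    moreover have "S * y\<^sup>2 / 6 - B * y / 2 = - 3 * B\<^sup>2 / (8 * M + 8 * B)"
    proof -
      have "S * y\<^sup>2 = 3 * B / 2 * y" using y(3) by (simp add: power2_eq_square)
      then have "S * y\<^sup>2 / 6 - B * y / 2 = - (B * y) / 4" by simp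
      also have "\<dots> = - 3 * B\<^sup>2 / (8 * M + 8 * B)"
        by (simp add: y_def S_def power2_eq_square)
      finally show ?thesis .
    qed
    ultimately have "\<bar>M * y\<^sup>2 - B * (1 - y\<^sup>2)\<bar> / 6 - B * y / 2
        = - B / 6 - 3 * B\<^sup>2 / (8 * M + 8 * B)"
      by (simp add: diff_divide_distrib)
    then show ?thesis by (intro that[OF y(1,2)]) (use 3 in simp)
  qed
qed

section \<open>The sharp bounds\<close>

theorem theorem2p2:
  fixes \<Phi> :: "complex \<Rightarrow> complex" and B1 :: real and B2 :: complex
  assumes "\<Phi> holomorphic_on unit_disc"
    and "inj_on \<Phi> unit_disc"
    and "\<Phi> 0 = 1"
    and "cnj ` (\<Phi> ` unit_disc) = \<Phi> ` unit_disc"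
    and "starlike_wrt 1 (\<Phi> ` unit_disc)"
    and "deriv \<Phi> 0 = complex_of_real B1" and "B1 > 0"
    and "B2 = taylor_coeff \<Phi> 2"
  shows "let M = cmod ((complex_of_real B1)\<^sup>2 + B2);
             U = (if M \<ge> 4 * B1 then (M - 3 * B1) / 6 else B1 / 6);
             L = (if B1 \<ge> 2 * M then (M - 3 * B1) / 6
                  else if 5 * B1 \<le> 4 * M then - (B1 / 2) * sqrt (B1 / (B1 + M))
                  else - B1 / 6 - 3 * B1\<^sup>2 / (8 * M + 8 * B1))
         in (\<forall>f\<in>Ma_Minda_convex \<Phi>.
               cmod (taylor_coeff f 3) - cmod (taylor_coeff f 2) \<le> U \<and>
               cmod (taylor_coeff f 3) - cmod (taylor_coeff f 2) \<ge> L) \<and>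
            (\<exists>f\<in>Ma_Minda_convex \<Phi>. cmod (taylor_coeff f 3) - cmod (taylor_coeff f 2) = U) \<and>
            (\<exists>f\<in>Ma_Minda_convex \<Phi>. cmod (taylor_coeff f 3) - cmod (taylor_coeff f 2) = L)"
proof -
  note \<Phi> = assms(1,3)
  define D where "D = (complex_of_real B1)\<^sup>2 + B2"
  define M where "M = cmod D"
  define U where "U = (if M \<ge> 4 * B1 then (M - 3 * B1) / 6 else B1 / 6)"
  define L where "L = (if B1 \<ge> 2 * M then (M - 3 * B1) / 6
                  else if 5 * B1 \<le> 4 * M then - (B1 / 2) * sqrt (B1 / (B1 + M))
                  else - B1 / 6 - 3 * B1\<^sup>2 / (8 * M + 8 * B1))"
  have B: "B1 > 0" and M: "M \<ge> 0" using assms(7) by (auto simp: M_def)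
  have D: "(deriv \<Phi> 0)\<^sup>2 + taylor_coeff \<Phi> 2 = D"
    by (simp only: assms(6,8) D_def)
  have bounds: "cmod (taylor_coeff f 3) - cmod (taylor_coeff f 2) \<le> U \<and>
      cmod (taylor_coeff f 3) - cmod (taylor_coeff f 2) \<ge> L" if f: "f \<in> Ma_Minda_convex \<Phi>" for f
  proof -
    obtain c1 c2 where c: "cmod c1 \<le> 1" "cmod c2 \<le> 1 - (cmod c1)\<^sup>2"
      and a2: "taylor_coeff f 2 = of_real B1 * c1 / 2"
      and a3: "taylor_coeff f 3 = (of_real B1 * c2 + D * c1\<^sup>2) / 6"
      using Ma_Minda_convex_coeffs[OF \<Phi>(1) f] unfolding D unfolding assms(6) by blast
    define x where "x = cmod c1"
    define t where "t = cmod (taylor_coeff f 3)"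
    have x: "0 \<le> x" "x \<le> 1" using c by (auto simp: x_def)
    have b2: "cmod (taylor_coeff f 2) = B1 * x / 2"
      using B by (simp add: a2 norm_mult norm_divide x_def)
    have Bc2: "cmod (of_real B1 * c2) \<le> B1 * (1 - x\<^sup>2)"
      using B c(2) by (simp add: norm_mult x_def)
    have Dc1: "cmod (D * c1\<^sup>2) = M * x\<^sup>2"
      by (simp add: norm_mult norm_power M_def x_def)
    have t6: "6 * t = cmod (of_real B1 * c2 + D * c1\<^sup>2)"
      by (simp add: t_def a3 norm_divide)
    have "6 * t \<le> B1 * (1 - x\<^sup>2) + M * x\<^sup>2"
      unfolding t6 using norm_triangle_ineq[of "of_real B1 * c2" "D * c1\<^sup>2"] Bc2 Dc1 by linarith
    then have "t - B1 * x / 2 \<le> U"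
      using upper_bound_real[OF B x, of M] unfolding U_def[symmetric] by argo
    moreover have "6 * t \<ge> M * x\<^sup>2 - B1 * (1 - x\<^sup>2)"
      unfolding t6 using norm_diff_ineq[of "D * c1\<^sup>2" "of_real B1 * c2"] Bc2 Dc1
      by (simp add: add.commute)
    then have "6 * t \<ge> (M + B1) * x\<^sup>2 - B1" by (simp add: algebra_simps)
    then have "t - B1 * x / 2 \<ge> L"
      unfolding L_def by (intro lower_bound_real B M x) (simp_all add: t_def)
    ultimately show ?thesis unfolding b2 t_def by simp
  qed
  have attained: "\<exists>f\<in>Ma_Minda_convex \<Phi>. cmod (taylor_coeff f 3) - cmod (taylor_coeff f 2)
      = cmod (of_real B1 * \<zeta> * of_real (1 - x\<^sup>2) + D * of_real (x\<^sup>2)) / 6 - B1 * x / 2"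
    if x: "0 \<le> x" "x \<le> 1" and \<zeta>: "cmod \<zeta> = 1" for x \<zeta>
  proof -
    obtain f where f: "f \<in> Ma_Minda_convex \<Phi>" "taylor_coeff f 2 = of_real B1 * of_real x / 2"
      "taylor_coeff f 3 = (of_real B1 * \<zeta> * of_real (1 - x\<^sup>2) + D * of_real (x\<^sup>2)) / 6"
      using Ma_Minda_convex_with_coeffs[OF \<Phi> x \<zeta>] unfolding D unfolding assms(6) by blast
    show ?thesis
      by (rule bexI[OF _ f(1)]) (use B x(1) in \<open>simp add: f(2,3) norm_mult norm_divide\<close>)
  qed
  \<comment> \<open>The extremal Schwarz functions are \<open>z\<close> and \<open>z\<^sup>2\<close>.\<close>
  have upper: "\<exists>f\<in>Ma_Minda_convex \<Phi>. cmod (taylor_coeff f 3) - cmod (taylor_coeff f 2) = U"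
  proof (cases "M \<ge> 4 * B1")
    case True
    have "M / 6 - B1 / 2 = U" using True by (simp add: U_def)
    then show ?thesis using attained[of 1 1] by (simp add: M_def)
  next
    case False
    have "B1 / 6 = U" using False by (simp add: U_def)
    then show ?thesis using attained[of 0 1] B by simp
  qed
  have lower: "\<exists>f\<in>Ma_Minda_convex \<Phi>. cmod (taylor_coeff f 3) - cmod (taylor_coeff f 2) = L"
  proof -
    \<comment> \<open>\<open>\<zeta> = - \<eta>\<close> makes the two terms of \<open>6 a3\<close> point in opposite directions.\<close>
    obtain \<eta> where \<eta>: "cmod \<eta> = 1" "D = of_real M * \<eta>"
    proof (cases "D = 0")
      case True
      then show ?thesis by (intro that[of 1]) (auto simp: M_def)
    next
      case False
      then show ?thesis by (intro that[of "sgn D"]) (auto simp: M_def norm_divide sgn_eq)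
    qed
    obtain x where x: "0 \<le> x" "x \<le> 1"
      and eq: "\<bar>M * x\<^sup>2 - B1 * (1 - x\<^sup>2)\<bar> / 6 - B1 * x / 2 = L"
      using lower_bound_attained_real[OF B M] unfolding L_def by blast
    have "of_real B1 * (- \<eta>) * of_real (1 - x\<^sup>2) + D * of_real (x\<^sup>2)
        = of_real (M * x\<^sup>2 - B1 * (1 - x\<^sup>2)) * \<eta>"
      unfolding \<eta>(2) by (simp add: algebra_simps)
    then have "cmod (of_real B1 * (- \<eta>) * of_real (1 - x\<^sup>2) + D * of_real (x\<^sup>2))
        = \<bar>M * x\<^sup>2 - B1 * (1 - x\<^sup>2)\<bar>"
      by (simp only: norm_mult norm_of_real \<eta>(1) mult_1_right)
    then show ?thesis using attained[OF x, of "- \<eta>"] \<eta>(1) eq by simp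
  qed
  show ?thesis
    unfolding Let_def D_def[symmetric] M_def[symmetric] U_def[symmetric] L_def[symmetric]
    using bounds upper lower by blast
qed

end
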